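(* Let $Q\ge 2$ be an integer and let $\mathbb{T}$ be the homogeneous tree of degree $Q+1$. Let $1\le p\le 2$ and let $z\in\mathbb{C}$ with $\operatorname{Re} z>0$. Then for every $f\in L^p(\mathbb{T})$ and every vertex $x\in\mathbb{T}$, $$\lim_{R\to+\infty} S_R^z f(x)=f(x),$$ where $S_R^z$ denotes the Riesz means operator on $\mathbb{T}$.
   Context: A homogeneous tree $\mathbb{T}$ of degree $Q+1$ ($Q\ge2$ an integer) is an infinite connected graph without cycles in which every vertex has exactly $Q+1$ neighbours; $\mathbb{T}$ is identified with its vertex set. $d(x,y)$ is the number of edges of the shortest path from $x$ to $y$, and $S(x,n)=\{y: d(x,y)=n\}$. $\mathbb{T}$ carries the counting measure, and $L^p(\mathbb{T})$ is the space of complex-valued functions $f$ on $\mathbb{T}$ with $\|f\|_p=(\sum_{x}|f(x)|^p)^{1/p}<\infty$ for $1\le p<\infty$, $\|f\|_\infty=\sup_x|f(x)|$. Fix a base point $x_0$ and set $|x|=d(x,x_0)$; a function is radial if it depends only on $|x|$, and one then writes $\kappa(n)$ for its value at $|x|=n$. For $\kappa$ radial, convolution is $$(f\ast\kappa)(x)=\sum_{n\ge0}\kappa(n)\sum_{y\in S(x,n)}f(y).$$ Mean operator and Laplacian: $(\mathcal{M}f)(x)=\frac1{Q+1}\sum_{d(x,y)=1}f(y)$, $\mathcal{L}=I-\mathcal{M}$. Put $\tau=2\pi/\log Q$ and $$\gamma(\lambda)=\frac{Q^{i\lambda}+Q^{-i\lambda}}{Q^{1/2}+Q^{-1/2}}=\frac{2\cos(\lambda\log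 Q)}{Q^{1/2}+Q^{-1/2}}.$$ The spherical function $\varphi_\lambda$ is the unique radial function with $\varphi_\lambda(x_0)=1$ and $\mathcal{M}\varphi_\lambda=\gamma(\lambda)\varphi_\lambda$ (equivalently $\mathcal{L}\varphi_\lambda=(1-\gamma(\lambda))\varphi_\lambda$). The spherical Fourier transform of a radial function $f$ is $(\mathcal{H}f)(\lambda)=\sum_{x\in\mathbb{T}}f(x)\varphi_\lambda(x)$. Its inverse is $\mathcal{H}^{-1}=\mathcal{A}^{-1}\circ\mathcal{F}^{-1}$, where $$(\mathcal{F}^{-1}m)(n)=\frac1\tau\int_{-\tau/2}^{\tau/2}m(\lambda)Q^{-i\lambda n}\,d\lambda,\qquad (\mathcal{A}^{-1}g)(n)=\sum_{k=0}^\infty Q^{-\frac n2-k}\{g(n+2k)-g(n+2k+2)\},\quad n\ge 0.$$ Riesz means: for $R>0$ and $\operatorname{Re}z>0$ let $$m_R^z(\lambda)=\Big(1-\frac{1-\gamma(\lambda)}{R}\Big)_+^z,\qquad \lambda\in\mathbb{R},$$ where $t_+^z=e^{z\log t}$ for $t>0$ and $t_+^z=0$ for $t\le0$. Let $\kappa_R^z=\mathcal{H}^{-1}(m_R^z)$ (a radial function), and $S_R^zf=f\ast\kappa_R^z$. *)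

theory Defs
  imports "HOL-Analysis.Analysis"
begin

(* A simple graph is given by its adjacency relation on the vertex type.
   A cycle is its list of pairwise distinct vertices; length at least 3 excludes
   going back and forth along a single edge. *)

definition graph_cycle :: "('v \<Rightarrow> 'v \<Rightarrow> bool) \<Rightarrow> 'v list \<Rightarrow> bool" where
  "graph_cycle adj xs \<longleftrightarrow>
     3 \<le> length xs \<and> distinct xs \<and> successively adj xs \<and> adj (last xs) (hd xs)"

(* The homogeneous tree of degree Q + 1.  The type 'v is the vertex set. *)

locale homogeneous_tree =
  fixes adj :: "'v \<Rightarrow> 'v \<Rightarrow> bool" and Q :: nat
  assumes infinite_vertices: "infinite (UNIV :: 'v set)"
    and adj_sym: "adj x y \<Longrightarrow> adj y x"
    and adj_irrefl: "\<not> adj x x"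
    and connected: "adj\<^sup>*\<^sup>* x y"
    and no_cycles: "\<not> graph_cycle adj xs"
    and degree: "card {y. adj x y} = Q + 1"

definition graph_dist :: "('v \<Rightarrow> 'v \<Rightarrow> bool) \<Rightarrow> 'v \<Rightarrow> 'v \<Rightarrow> nat" where
  "graph_dist adj x y = (LEAST n. (adj ^^ n) x y)"

definition graph_sphere :: "('v \<Rightarrow> 'v \<Rightarrow> bool) \<Rightarrow> 'v \<Rightarrow> nat \<Rightarrow> 'v set" where
  "graph_sphere adj x n = {y. graph_dist adj x y = n}"

(* Membership in the space L^p of the counting measure, for finite p. *)

definition in_Lp :: "real \<Rightarrow> ('v \<Rightarrow> complex) \<Rightarrow> bool" where
  "in_Lp p f \<longleftrightarrow> (\<lambda>x. norm (f x) powr p) summable_on UNIV"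

(* A radial function is represented by its profile k, k n being its value at
   distance n from the base point; the convolution does not depend on the base point. *)

definition radial_convolution ::
    "('v \<Rightarrow> 'v \<Rightarrow> bool) \<Rightarrow> ('v \<Rightarrow> complex) \<Rightarrow> (nat \<Rightarrow> complex) \<Rightarrow> 'v \<Rightarrow> complex" where
  "radial_convolution adj f k x = (\<Sum>n. k n * (\<Sum>y\<in>graph_sphere adj x n. f y))"

definition tree_period :: "nat \<Rightarrow> real" where
  "tree_period Q = 2 * pi / ln (real Q)"

(* Equals (Q^(i l) + Q^(-i l)) / (Q^(1/2) + Q^(-1/2)), which is real for real l. *)

definition tree_gamma :: "nat \<Rightarrow> real \<Rightarrow> real" where
  "tree_gamma Q l =
     2 * cos (l * ln (real Q)) / (real Q powr (1/2) + real Q powr (-1/2))"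

definition inverse_Fourier :: "nat \<Rightarrow> (real \<Rightarrow> complex) \<Rightarrow> int \<Rightarrow> complex" where
  "inverse_Fourier Q m n =
     complex_of_real (1 / tree_period Q) *
     integral {- tree_period Q / 2 .. tree_period Q / 2}
       (\<lambda>l. m l * of_nat Q powr (- \<i> * complex_of_real l * of_int n))"

definition inverse_Abel :: "nat \<Rightarrow> (int \<Rightarrow> complex) \<Rightarrow> nat \<Rightarrow> complex" where
  "inverse_Abel Q g n =
     (\<Sum>k::nat. complex_of_real (real Q powr (- real n / 2 - real k)) *
        (g (int n + 2 * int k) - g (int n + 2 * int k + 2)))"

definition inverse_spherical :: "nat \<Rightarrow> (real \<Rightarrow> complex) \<Rightarrow> nat \<Rightarrow> complex" where
  "inverse_spherical Q m = inverse_Abel Q (inverse_Fourier Q m)"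

definition pos_part_power :: "real \<Rightarrow> complex \<Rightarrow> complex" where
  "pos_part_power t z = (if 0 < t then exp (z * complex_of_real (ln t)) else 0)"

definition riesz_multiplier :: "nat \<Rightarrow> real \<Rightarrow> complex \<Rightarrow> real \<Rightarrow> complex" where
  "riesz_multiplier Q R z l = pos_part_power (1 - (1 - tree_gamma Q l) / R) z"

definition riesz_kernel :: "nat \<Rightarrow> real \<Rightarrow> complex \<Rightarrow> nat \<Rightarrow> complex" where
  "riesz_kernel Q R z = inverse_spherical Q (riesz_multiplier Q R z)"

definition riesz_mean ::
    "('v \<Rightarrow> 'v \<Rightarrow> bool) \<Rightarrow> nat \<Rightarrow> real \<Rightarrow> complex \<Rightarrow> ('v \<Rightarrow> complex) \<Rightarrow> 'v \<Rightarrow> complex" where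
  "riesz_mean adj Q R z f = radial_convolution adj f (riesz_kernel Q R z)"

end

theory Submission
  imports Defs
begin

text \<open>
  For large \<open>R\<close> the binomial series expands the multiplier uniformly in powers of
  \<open>(1 - \<gamma>) / R\<close>. The \<open>j\<close>-th power is a trigonometric polynomial of degree \<open>j\<close>, so the \<open>n\<close>-th
  Fourier coefficient only sees the tail \<open>j \<ge> n\<close> and is \<open>O((C / R)\<^sup>n)\<close>. The inverse Abel
  transform preserves this bound, and it beats the growth \<open>(Q + 1)\<^sup>n\<close> of the spheres once \<open>R\<close> is
  large, so \<open>S\<^sub>R f(x) - f(x) = O(\<parallel>f\<parallel>\<^sub>\<infinity> / R)\<close>, and \<open>L\<^sup>p\<close> functions of the counting
  measure are bounded.
\<close>

section \<open>Fourier coefficients of the multiplier\<close>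

text \<open>The exponential inside \<open>inverse_Fourier\<close>, kept in literally the same form
  so that unfolding both definitions makes the integrands agree.\<close>

definition fourier_char :: "nat \<Rightarrow> int \<Rightarrow> real \<Rightarrow> complex" where
  "fourier_char Q n l = of_nat Q powr (- \<i> * complex_of_real l * of_int n)"

lemma fourier_char_eq:
  assumes "2 \<le> Q"
  shows "fourier_char Q n l = cis (- (l * of_int n * ln (real Q)))"
proof -
  have "Ln (of_nat Q :: complex) = of_real (ln (real Q))"
    using assms Ln_of_real[of "real Q"] by simp
  then show ?thesis
    using assms by (simp add: fourier_char_def powr_def cis_conv_exp mult_ac)
qed

lemma fourier_char_0: "2 \<le> Q \<Longrightarrow> fourier_char Q 0 l = 1"
  by (simp add: fourier_char_eq)

lemma norm_fourier_char: "2 \<le> Q \<Longrightarrow> norm (fourier_char Q n l) = 1"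
  by (simp add: fourier_char_eq)

lemma continuous_on_fourier_char: "2 \<le> Q \<Longrightarrow> continuous_on S (fourier_char Q n)"
  by (auto simp: fourier_char_eq cis_conv_exp cong: continuous_on_cong intro!: continuous_intros)

text \<open>The antiderivative takes equal values at the two ends of the period, whose phases
  -\<pi>n and \<pi>n differ by a multiple of 2\<pi>.\<close>

lemma has_integral_fourier_char:
  assumes Q: "2 \<le> Q" and n: "n \<noteq> 0"
  shows "(fourier_char Q n has_integral 0) {- tree_period Q / 2 .. tree_period Q / 2}"
proof -
  define c where "c = - (of_int n * ln (real Q))"
  have L: "ln (real Q) > 0" using Q by simp
  have c: "c \<noteq> 0" using n L by (simp add: c_def)
  have eq: "fourier_char Q n = (\<lambda>l. cis (c * l))"
    using Q by (auto simp: fourier_char_eq c_def mult_ac fun_eq_iff)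
  have d: "((\<lambda>l. cis (c * l) / (\<i> * of_real c)) has_vector_derivative cis (c * l)) (at l within S)"
    for l S
    using c unfolding cis_conv_exp
    by (auto intro!: derivative_eq_intros has_vector_derivative_real_field simp: field_simps)
  have T: "0 < tree_period Q" using L by (simp add: tree_period_def)
  have e: "c * (tree_period Q / 2) = - pi * of_int n"
    using L by (simp add: c_def tree_period_def)
  have e': "c * (- tree_period Q / 2) = pi * of_int n"
    using L by (simp add: c_def tree_period_def)
  have "cis (- pi * of_int n) = cis (pi * of_int n)"
    by (simp add: complex_eq_iff sin_integer_2pi mult.commute)
  then have "((\<lambda>l. cis (c * l)) has_integral 0) {- tree_period Q / 2 .. tree_period Q / 2}"
    using fundamental_theorem_of_calculus[OF _ d, of "- tree_period Q / 2" "tree_period Q / 2"] T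
    unfolding e e' by simp
  then show ?thesis by (simp add: eq)
qed

text \<open>By 2 cos t = e^(it) + e^(-it), multiplication by \<gamma> moves a frequency by one in
  each direction.\<close>

lemma tree_gamma_fourier_char:
  assumes Q: "2 \<le> Q"
  defines "b \<equiv> 1 / (real Q powr (1/2) + real Q powr (-1/2))"
  shows "of_real (tree_gamma Q l) * fourier_char Q n l =
    of_real b * (fourier_char Q (n + 1) l + fourier_char Q (n - 1) l)"
proof -
  let ?t = "l * ln (real Q)"
  have "cis (- (?t * of_int (n + 1))) = cis (- ?t) * cis (- (?t * of_int n))"
    "cis (- (?t * of_int (n - 1))) = cis ?t * cis (- (?t * of_int n))"
    by (simp_all add: cis_mult algebra_simps)
  moreover have "cis (- ?t) + cis ?t = of_real (2 * cos ?t)"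
    by (simp add: complex_eq_iff)
  moreover have "tree_gamma Q l = b * (2 * cos ?t)"
    by (simp add: tree_gamma_def b_def)
  moreover have "fourier_char Q k l = cis (- (?t * of_int k))" for k
    using Q by (simp add: fourier_char_eq mult_ac)
  ultimately show ?thesis
    by (simp only: of_real_mult distrib_right[symmetric] mult.assoc)
qed

text \<open>Each factor 1 - \<gamma> moves frequencies by at most one, so j < |n| factors cannot
  bring frequency n to 0, the only one with nonzero integral. The induction generalizes
  \<open>n\<close> because its step also uses n + 1 and n - 1.\<close>

lemma has_integral_gamma_power_fourier_char:
  assumes Q: "2 \<le> Q" and "int j < \<bar>n\<bar>"
  shows "((\<lambda>l. of_real (1 - tree_gamma Q l) ^ j * fourier_char Q n l) has_integral 0)
    {- tree_period Q / 2 .. tree_period Q / 2}"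
  using assms(2)
proof (induction j arbitrary: n)
  case 0
  then show ?case using has_integral_fourier_char[OF Q] by simp
next
  case (Suc j)
  define b :: complex where "b = of_real (1 / (real Q powr (1/2) + real Q powr (-1/2)))"
  let ?I = "\<lambda>n l. of_real (1 - tree_gamma Q l) ^ j * fourier_char Q n l"
  have "((\<lambda>l. ?I n l - b * (?I (n + 1) l + ?I (n - 1) l)) has_integral 0 - b * (0 + 0))
      {- tree_period Q / 2 .. tree_period Q / 2}"
    using Suc.prems
    by (intro has_integral_diff has_integral_mult_right has_integral_add Suc.IH) auto
  moreover have "?I n l - b * (?I (n + 1) l + ?I (n - 1) l) =
      of_real (1 - tree_gamma Q l) ^ Suc j * fourier_char Q n l" for l
  proof -
    let ?X = "of_real (1 - tree_gamma Q l) :: complex" and ?E = "\<lambda>k. fourier_char Q k l"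
    have "?X * ?E n = ?E n - b * (?E (n + 1) + ?E (n - 1))"
      using tree_gamma_fourier_char[OF Q, of l n] unfolding b_def[symmetric]
      by (simp add: left_diff_distrib)
    then have "?X ^ Suc j * ?E n = ?X ^ j * (?E n - b * (?E (n + 1) + ?E (n - 1)))"
      by (simp only: power_Suc2 mult.assoc)
    then show ?thesis by (simp add: right_diff_distrib distrib_left mult.left_commute)
  qed
  ultimately show ?case by simp
qed

section \<open>Continuity and size of \<gamma>; the tail of the binomial series\<close>

lemma continuous_on_tree_gamma: "continuous_on S (tree_gamma Q)"
proof (cases "Q = 0")
  \<comment> \<open>Here the denominator is 0, and division by zero makes \<open>tree_gamma\<close>
    the constant 0.\<close>
  case True
  then show ?thesis by (simp add: tree_gamma_def[abs_def])
next
  case False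
  then have "real Q powr (1/2) + real Q powr (-1/2) \<noteq> 0"
    by (simp add: add_nonneg_eq_0_iff)
  then show ?thesis unfolding tree_gamma_def[abs_def] by (intro continuous_intros) auto
qed

text \<open>The denominator is at least Q^(1/2) \<ge> 1. The resulting |1 - \<gamma>| \<le> 3 is the
  origin of the factor 3 in the later estimates.\<close>

lemma abs_tree_gamma_le:
  assumes "2 \<le> Q"
  shows "\<bar>tree_gamma Q l\<bar> \<le> 2"
proof -
  let ?d = "real Q powr (1/2) + real Q powr (-1/2)"
  have d: "1 \<le> ?d" using assms by (intro add_increasing2 ge_one_powr_ge_zero) auto
  have "\<bar>2 * cos (l * ln (real Q))\<bar> \<le> 2" by (simp add: abs_mult)
  also have "\<dots> \<le> 2 * ?d" using d by simp
  finally show ?thesis using d by (simp add: tree_gamma_def field_simps)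
qed

text \<open>Induction by (k + 1) (a choose k + 1) = (a - k) (a choose k), with |a| + k \<le> (k + 1)
  (|a| + 1). Geometric growth allows comparison with a geometric series.\<close>

lemma norm_gbinomial_le:
  fixes a :: "'a :: real_normed_field"
  shows "norm (a gchoose k) \<le> (norm a + 1) ^ k"
proof (induction k)
  case (Suc k)
  have "norm (of_nat (Suc k) * (a gchoose Suc k)) = norm ((a - of_nat k) * (a gchoose k))"
    using gbinomial_mult_1[of a k] by (simp add: algebra_simps)
  then have "real (Suc k) * norm (a gchoose Suc k) = norm (a - of_nat k) * norm (a gchoose k)"
    by (simp only: norm_mult norm_of_nat)
  also have "\<dots> \<le> (norm a + real k) * (norm a + 1) ^ k"
    using norm_triangle_ineq4[of a "of_nat k"] Suc by (intro mult_mono) auto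
  also have "\<dots> \<le> (real (Suc k) * (norm a + 1)) * (norm a + 1) ^ k"
    by (intro mult_right_mono) (auto simp: algebra_simps)
  finally show ?case by (simp add: mult.assoc)
qed simp

text \<open>The \<open>j\<close>-th term is at most \<open>r ^ j\<close>, so the tail from
  \<open>N\<close> on is at most r^N / (1 - r), and r \<le> 1/2 gives the factor 2.\<close>

lemma binomial_series_remainder:
  fixes z w :: complex
  assumes r: "(norm z + 1) * norm w \<le> r" "r \<le> 1/2"
  shows "norm ((1 + w) powr z - (\<Sum>j<N. (z gchoose j) * w ^ j)) \<le> 2 * r ^ N"
proof -
  let ?t = "\<lambda>j. (z gchoose j) * w ^ j"
  \<comment> \<open>As \<open>norm z + 1\<close> is at least 1, the bound on \<open>r\<close> also
    places \<open>w\<close> inside the disc of convergence.\<close>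
  have "norm w \<le> (norm z + 1) * norm w" by (simp add: algebra_simps)
  then have w: "norm w < 1" using r by simp
  have r0: "0 \<le> r" using r(1) by (rule order_trans[rotated]) simp
  have s: "?t sums ((1 + w) powr z)" by (rule gen_binomial_complex[OF w])
  have t: "norm (?t j) \<le> r ^ j" for j
  proof -
    have "norm (?t j) \<le> (norm z + 1) ^ j * norm w ^ j"
      by (simp add: norm_mult norm_power mult_right_mono norm_gbinomial_le)
    also have "\<dots> \<le> r ^ j"
      unfolding power_mult_distrib[symmetric] using r by (intro power_mono) auto
    finally show ?thesis .
  qed
  have g: "(\<lambda>j. r ^ N * r ^ j) sums (r ^ N * (1 / (1 - r)))"
    using r r0 by (intro sums_mult geometric_sums) auto
  have "(1 + w) powr z - (\<Sum>j<N. ?t j) = (\<Sum>j. ?t (j + N))"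
    using suminf_minus_initial_segment[OF sums_summable[OF s], of N] sums_unique[OF s] by simp
  also have "norm \<dots> \<le> (\<Sum>j. r ^ N * r ^ j)"
    using t[of "_ + N"] sums_summable[OF g]
    by (intro norm_suminf_le) (auto simp: power_add mult.commute)
  also have "\<dots> = r ^ N * (1 / (1 - r))" using sums_unique[OF g] by simp
  also have "\<dots> \<le> r ^ N * 2" using r r0 by (intro mult_left_mono) (auto simp: field_simps)
  finally show ?thesis by (simp add: mult.commute)
qed

text \<open>The multiplier is uniformly within 2 r^N of its binomial polynomial of degree below N.
  The n-th coefficient of that polynomial is exactly the delta: for n > 0 all powers j < n integrate
  to 0, and for n = 0 only the constant term 1 is kept.\<close>

lemma inverse_Fourier_riesz_multiplier:
  fixes z :: complex
  assumes Q: "2 \<le> Q" and R: "0 < R" and r: "3 * (norm z + 1) / R \<le> 1/2"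
  shows "norm (inverse_Fourier Q (riesz_multiplier Q R z) (int n) - (if n = 0 then 1 else 0))
    \<le> 2 * (3 * (norm z + 1) / R) ^ max n 1"
proof -
  define r where "r = 3 * (norm z + 1) / R"
  \<comment> \<open>The maximum keeps the constant term at n = 0 too, so that the error there is
    still O(1/R).\<close>
  define N where "N = max n 1"
  define T where "T = tree_period Q"
  let ?J = "{- T / 2 .. T / 2}"
  define u where "u l = - ((1 - tree_gamma Q l) / R)" for l
  define m where "m = riesz_multiplier Q R z"
  define P where "P l = (\<Sum>j<N. (z gchoose j) * of_real (u l) ^ j)" for l
  have T: "T > 0" using Q by (simp add: T_def tree_period_def)
  have z3: "3 / R \<le> r" using R by (simp add: r_def field_simps)
  have u: "\<bar>u l\<bar> \<le> 3 / R" for l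
    using abs_tree_gamma_le[OF Q, of l] R by (simp add: u_def divide_right_mono)
  \<comment> \<open>Since |u| \<le> 3/R \<le> r \<le> 1/2, the cut-off in
    \<open>pos_part_power\<close> never acts and the multiplier is a genuine complex power.\<close>
  have u1: "0 < 1 + u l" for l
    using u[of l] z3 r unfolding r_def[symmetric] by linarith
  have m: "m l = (1 + of_real (u l)) powr z" for l
  proof -
    have "1 - (1 - tree_gamma Q l) / R = 1 + u l" by (simp add: u_def)
    moreover have "1 + of_real (u l) = (of_real (1 + u l) :: complex)" by simp
    moreover have "of_real (1 + u l) powr z = exp (z * of_real (ln (1 + u l)))"
      unfolding powr_def Ln_of_real[OF u1] using u1[of l] by (simp del: of_real_add)
    ultimately show ?thesis
      using u1[of l] by (simp only: m_def riesz_multiplier_def pos_part_power_def if_True)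
  qed
  have diff: "norm (m l - P l) \<le> 2 * r ^ N" for l
  proof -
    have "(norm z + 1) * norm (of_real (u l) :: complex) \<le> (norm z + 1) * (3 / R)"
      using u[of l] by (intro mult_left_mono) auto
    also have "\<dots> = r" by (simp add: r_def)
    finally show ?thesis
      unfolding m P_def using r by (intro binomial_series_remainder) (auto simp: r_def)
  qed
  have cu: "continuous_on S u" for S
    unfolding u_def[abs_def] by (intro continuous_intros continuous_on_tree_gamma) (use R in auto)
  \<comment> \<open>This form has no case distinction, so continuity can be read off.\<close>
  have "m = (\<lambda>l. exp (z * of_real (ln (1 + u l))))"
  proof
    fix l
    show "m l = exp (z * of_real (ln (1 + u l)))"
      using u1[of l] by (simp add: m_def riesz_multiplier_def pos_part_power_def u_def)
  qed
  then have cm: "continuous_on S m" for S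
    using u1 by (auto intro!: continuous_intros cu simp: less_imp_neq[symmetric])
  have cP: "continuous_on S P" for S
    unfolding P_def[abs_def] by (intro continuous_intros cu)
  let ?d = "if n = 0 then 1 else 0 :: complex"
  have P: "((\<lambda>l. P l * fourier_char Q (int n) l) has_integral of_real T * ?d) ?J"
  proof (cases "n = 0")
    case True
    have "((\<lambda>l. 1::complex) has_integral of_real T) ?J"
      using T has_integral_const_real[of "1::complex" "- T / 2" "T / 2"]
      by (simp add: scaleR_conv_of_real)
    then show ?thesis
      using True Q by (simp add: P_def N_def fourier_char_0)
  next
    case False
    have "((\<lambda>l. \<Sum>j<N. ((z gchoose j) * (- 1 / of_real R) ^ j) *
        (of_real (1 - tree_gamma Q l) ^ j * fourier_char Q (int n) l)) has_integral
        (\<Sum>j<N. ((z gchoose j) * (- 1 / of_real R) ^ j) * 0)) ?J"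
      unfolding T_def
      by (intro has_integral_sum has_integral_mult_right has_integral_gamma_power_fourier_char Q)
        (use False in \<open>auto simp: N_def\<close>)
    moreover have "(\<Sum>j<N. ((z gchoose j) * (- 1 / of_real R) ^ j) *
        (of_real (1 - tree_gamma Q l) ^ j * fourier_char Q (int n) l)) =
        P l * fourier_char Q (int n) l" for l
    proof -
      have "of_real (u l) = (- 1 / of_real R) * (of_real (1 - tree_gamma Q l) :: complex)"
        by (simp add: u_def)
      then have "P l = (\<Sum>j<N. (z gchoose j) *
          ((- 1 / of_real R) ^ j * of_real (1 - tree_gamma Q l) ^ j))"
        unfolding P_def by (simp only: power_mult_distrib)
      then show ?thesis by (simp only: sum_distrib_right mult.assoc)
    qed
    ultimately show ?thesis using False by simp
  qed
  have int: "(\<lambda>l. (m l - P l) * fourier_char Q (int n) l) integrable_on ?J"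
    by (intro integrable_continuous_real continuous_intros cm cP continuous_on_fourier_char Q)
  have b: "norm (integral ?J (\<lambda>l. (m l - P l) * fourier_char Q (int n) l)) \<le> 2 * r ^ N * (T / 2 - (- T / 2))"
    using T diff Q
    by (intro integral_bound continuous_intros cm cP continuous_on_fourier_char)
      (auto simp: norm_mult norm_fourier_char)
  have "((\<lambda>l. m l * fourier_char Q (int n) l) has_integral
      integral ?J (\<lambda>l. (m l - P l) * fourier_char Q (int n) l) + of_real T * ?d) ?J"
    using has_integral_add[OF integrable_integral[OF int] P] by (simp add: algebra_simps)
  then have "inverse_Fourier Q m (int n) - ?d =
      of_real (1 / T) * integral ?J (\<lambda>l. (m l - P l) * fourier_char Q (int n) l)"
    using T by (simp add: inverse_Fourier_def T_def[symmetric] fourier_char_def integral_unique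
      field_simps)
  also have "norm \<dots> \<le> (1 / T) * (2 * r ^ N * (T / 2 - (- T / 2)))"
    unfolding norm_mult using T b by (intro mult_mono) (auto simp: norm_divide)
  also have "\<dots> = 2 * r ^ N" using T by simp
  finally show ?thesis by (simp add: m_def r_def N_def)
qed

section \<open>The kernel\<close>

text \<open>The transform maps the delta at 0 to itself, and at n it reads only arguments \<ge> n.
  Differences of the error are at most 2B and the weights at most 2^(-k), which sums to 4B.\<close>

lemma inverse_Abel_approx_delta:
  fixes g :: "int \<Rightarrow> complex"
  assumes Q: "2 \<le> Q"
    and B: "\<And>m. n \<le> m \<Longrightarrow> norm (g (int m) - (if m = 0 then 1 else 0)) \<le> B"
  shows "norm (inverse_Abel Q g n - (if n = 0 then 1 else 0)) \<le> 4 * B"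
proof -
  define h where "h m = g (int m) - (if m = 0 then 1 else 0)" for m
  define w where "w k = real Q powr (- real n / 2 - real k)" for k
  define t where "t k = of_real (w k) * (h (n + 2 * k) - h (n + 2 * k + 2))" for k
  have w: "0 \<le> w k" "w k \<le> (1/2) ^ k" for k
  proof -
    have "w k \<le> real Q powr (- real k)" unfolding w_def using Q by (intro powr_mono) auto
    also have "\<dots> = (1 / real Q) ^ k"
      using Q by (simp add: powr_minus powr_realpow power_divide divide_inverse power_inverse)
    also have "\<dots> \<le> (1/2) ^ k" using Q by (intro power_mono) (auto simp: field_simps)
    finally show "w k \<le> (1/2) ^ k" .
  qed (simp add: w_def)
  have B0: "0 \<le> B" using B[of n] by (rule order_trans[rotated]) auto
  have t: "norm (t k) \<le> 2 * B * (1/2) ^ k" for k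
  proof -
    have "norm (h (n + 2 * k) - h (n + 2 * k + 2)) \<le> B + B"
      by (rule order_trans[OF norm_triangle_ineq4]) (intro add_mono, auto simp only: h_def intro!: B)
    then have "norm (t k) \<le> (1/2) ^ k * (B + B)"
      unfolding t_def norm_mult using w[of k] by (intro mult_mono) auto
    then show ?thesis by (simp add: mult.commute)
  qed
  have g: "(\<lambda>k. 2 * B * (1/2) ^ k) sums (2 * B * (1 / (1 - 1/2)))"
    by (intro sums_mult geometric_sums) auto
  have st: "summable t" by (rule summable_comparison_test'[OF sums_summable[OF g] t])
  have d: "(\<lambda>k. if k = 0 then (if n = 0 then 1 else 0) else 0 :: complex) sums (if n = 0 then 1 else 0)"
    using sums_single[of 0 "\<lambda>_. if n = 0 then 1 else 0 :: complex"] by simp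
  \<comment> \<open>n + 2k vanishes only for n = k = 0, where the weight is 1, and n + 2k + 2 never
    vanishes.\<close>
  have "of_real (w k) * (g (int n + 2 * int k) - g (int n + 2 * int k + 2)) =
      t k + (if k = 0 then (if n = 0 then 1 else 0) else 0)" for k
    using Q by (auto simp: t_def h_def w_def algebra_simps)
  then have "(\<lambda>k. of_real (w k) * (g (int n + 2 * int k) - g (int n + 2 * int k + 2))) sums
      (suminf t + (if n = 0 then 1 else 0))"
    using sums_add[OF summable_sums[OF st] d] by simp
  then have "inverse_Abel Q g n = suminf t + (if n = 0 then 1 else 0)"
    unfolding inverse_Abel_def w_def by (rule sums_unique[symmetric])
  moreover have "norm (suminf t) \<le> 4 * B"
    using norm_suminf_le[OF t sums_summable[OF g]] sums_unique[OF g] by simp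
  ultimately show ?thesis by simp
qed

text \<open>The ratio is below 1, so the bound at n dominates all Fourier coefficients m \<ge> n,
  the only ones the inverse Abel transform sees at n. The 8 is 4 times 2.\<close>

lemma riesz_kernel_approx_delta:
  fixes z :: complex
  assumes Q: "2 \<le> Q" and R: "0 < R" and r: "3 * (norm z + 1) / R \<le> 1/2"
  shows "norm (riesz_kernel Q R z n - (if n = 0 then 1 else 0))
    \<le> 8 * (3 * (norm z + 1) / R) ^ max n 1"
proof -
  let ?r = "3 * (norm z + 1) / R"
  have "norm (inverse_Fourier Q (riesz_multiplier Q R z) (int m) - (if m = 0 then 1 else 0))
      \<le> 2 * ?r ^ max n 1" if "n \<le> m" for m
  proof -
    have "?r ^ max m 1 \<le> ?r ^ max n 1"
      using that r R by (intro power_decreasing) auto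
    then show ?thesis
      using inverse_Fourier_riesz_multiplier[OF Q R r, of m] by linarith
  qed
  from inverse_Abel_approx_delta[OF Q this] show ?thesis
    by (simp add: riesz_kernel_def inverse_spherical_def)
qed

section \<open>Spheres\<close>

context homogeneous_tree
begin

text \<open>Infinite sets have \<open>card\<close> 0, while the degree is positive.\<close>

lemma finite_neighbours: "finite {y. adj x y}"
  using degree[of x] by (intro card_ge_0_finite) simp

text \<open>Each walk extends in Q + 1 ways. Finiteness is carried along because the union bound
  needs a finite index set.\<close>

lemma finite_card_walks: "finite {y. (adj ^^ n) x y} \<and> card {y. (adj ^^ n) x y} \<le> (Q + 1) ^ n"
proof (induction n)
  case (Suc n)
  let ?W = "{y. (adj ^^ n) x y}"
  have eq: "{y. (adj ^^ Suc n) x y} = (\<Union>y\<in>?W. {u. adj y u})" by auto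
  have "card (\<Union>y\<in>?W. {u. adj y u}) \<le> (\<Sum>y\<in>?W. card {u. adj y u})"
    using Suc by (intro card_UN_le) simp
  also have "\<dots> = card ?W * (Q + 1)" by (simp add: degree)
  also have "\<dots> \<le> (Q + 1) ^ n * (Q + 1)" using Suc by (intro mult_right_mono) auto
  finally have "card {y. (adj ^^ Suc n) x y} \<le> (Q + 1) ^ Suc n" unfolding eq by (simp add: mult.commute)
  then show ?case using Suc finite_neighbours unfolding eq by auto
qed simp

text \<open>Connectedness provides some walk, so the \<open>LEAST\<close> in
  \<open>graph_dist\<close> is attained.\<close>

lemma walk_graph_dist: "(adj ^^ graph_dist adj x y) x y"
proof -
  obtain n where "(adj ^^ n) x y" using connected[of x y] by (auto simp: rtranclp_power)
  then show ?thesis unfolding graph_dist_def by (rule LeastI)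
qed

lemma card_graph_sphere_le: "card (graph_sphere adj x n) \<le> (Q + 1) ^ n"
proof -
  have "graph_sphere adj x n \<subseteq> {y. (adj ^^ n) x y}"
    using walk_graph_dist by (auto simp: graph_sphere_def)
  then show ?thesis using finite_card_walks[of n x] card_mono by (blast intro: order_trans)
qed

lemma graph_sphere_0: "graph_sphere adj x 0 = {x}"
proof -
  have "y = x" if "graph_dist adj x y = 0" for y
    using walk_graph_dist[of x y] that by simp
  moreover have "graph_dist adj x x = 0" unfolding graph_dist_def by (rule Least_eq_0) simp
  ultimately show ?thesis by (auto simp: graph_sphere_def)
qed

section \<open>Convolution with a kernel close to the delta\<close>

text \<open>Spheres grow at most like (Q + 1)^n and the kernel error decays like r^n, so the terms
  are controlled by powers of q = r (Q + 1) \<le> 1/2. Keeping one factor q makes the total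
  proportional to r.\<close>

lemma radial_convolution_approx_identity:
  fixes f :: "'v \<Rightarrow> complex"
  assumes M: "\<And>y. norm (f y) \<le> M"
    and k: "\<And>n. norm (k n - (if n = 0 then 1 else 0)) \<le> C * r ^ max n 1"
    and C: "0 \<le> C" and r: "0 \<le> r" "r * (real Q + 1) \<le> 1/2"
  shows "norm (radial_convolution adj f k x - f x) \<le> 4 * C * M * (real Q + 1) * r"
proof -
  define s where "s n = (\<Sum>y\<in>graph_sphere adj x n. f y)" for n
  define t where "t n = (k n - (if n = 0 then 1 else 0)) * s n" for n
  define q where "q = r * (real Q + 1)"
  have M0: "0 \<le> M" using M[of x] by (rule order_trans[rotated]) simp
  have q: "0 \<le> q" "q \<le> 1/2" using r by (auto simp: q_def)
  have s: "norm (s n) \<le> (real Q + 1) ^ n * M" for n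
  proof -
    have "norm (s n) \<le> of_nat (card (graph_sphere adj x n)) * M"
      unfolding s_def by (rule sum_norm_bound) (rule M)
    also have "\<dots> \<le> of_nat ((Q + 1) ^ n) * M"
      using card_graph_sphere_le M0 by (intro mult_right_mono of_nat_mono) auto
    finally show ?thesis by (simp add: add.commute)
  qed
  \<comment> \<open>For n = 0 the maximum supplies a factor r \<le> q. For n > 0 one q is kept and
    the others become 1/2, which costs the factor 2.\<close>
  have pow: "r ^ max n 1 * (real Q + 1) ^ n \<le> 2 * q * (1/2) ^ n" for n
  proof (cases n)
    case 0
    have "r * 1 \<le> 2 * (r * (real Q + 1))" using r by (auto simp: algebra_simps)
    then show ?thesis using 0 by (simp add: q_def)
  next
    case (Suc i)
    have "r ^ max n 1 * (real Q + 1) ^ n = q * q ^ i"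
      using Suc by (simp add: q_def power_mult_distrib)
    also have "\<dots> \<le> q * (1/2) ^ i" using q by (intro mult_left_mono power_mono) auto
    finally show ?thesis using Suc by simp
  qed
  have t: "norm (t n) \<le> C * M * (2 * q) * (1/2) ^ n" for n
  proof -
    have "norm (t n) \<le> (C * r ^ max n 1) * ((real Q + 1) ^ n * M)"
      unfolding t_def norm_mult using k s C r by (intro mult_mono) auto
    also have "\<dots> = C * M * (r ^ max n 1 * (real Q + 1) ^ n)" by (simp add: mult_ac)
    also have "\<dots> \<le> C * M * (2 * q * (1/2) ^ n)"
      using C M0 by (intro mult_left_mono pow) auto
    finally show ?thesis by (simp add: mult_ac)
  qed
  have g: "(\<lambda>n. C * M * (2 * q) * (1/2) ^ n) sums (C * M * (2 * q) * (1 / (1 - 1/2)))"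
    by (intro sums_mult geometric_sums) auto
  have st: "summable t" by (rule summable_comparison_test'[OF sums_summable[OF g] t])
  have d: "(\<lambda>n. if n = 0 then f x else 0) sums f x"
    using sums_single[of 0 "\<lambda>_. f x"] by simp
  have "k n * s n = t n + (if n = 0 then f x else 0)" for n
    by (simp add: t_def s_def graph_sphere_0 algebra_simps)
  then have "(\<lambda>n. k n * s n) sums (suminf t + f x)"
    using sums_add[OF summable_sums[OF st] d] by simp
  then have "radial_convolution adj f k x = suminf t + f x"
    unfolding radial_convolution_def s_def by (rule sums_unique[symmetric])
  moreover have "norm (suminf t) \<le> C * M * (2 * q) * 2"
    using norm_suminf_le[OF t sums_summable[OF g]] sums_unique[OF g] by simp
  ultimately show ?thesis by (simp add: q_def mult_ac)
qed

end

section \<open>Boundedness of \<open>f\<close> and passage to the limit\<close>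

text \<open>One term of a nonnegative summable family is at most its sum, so the L^p norm itself
  serves as \<open>M\<close>.\<close>

lemma in_Lp_bounded:
  assumes "in_Lp p f" and p: "0 < p"
  obtains M where "\<And>x. norm (f x) \<le> M"
proof
  fix x
  let ?S = "\<Sum>\<^sub>\<infinity>y. norm (f y) powr p"
  have "norm (f x) powr p \<le> ?S"
    using finite_sum_le_infsum[of "\<lambda>y. norm (f y) powr p" UNIV "{x}"] assms
    by (simp add: in_Lp_def)
  then have "(norm (f x) powr p) powr (1 / p) \<le> ?S powr (1 / p)"
    using p by (intro powr_mono2) auto
  then show "norm (f x) \<le> ?S powr (1 / p)" using p by (simp add: powr_powr)
qed

theorem theorem1:
  fixes adj :: "'v \<Rightarrow> 'v \<Rightarrow> bool" and Q :: nat and p :: real and z :: complex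
    and f :: "'v \<Rightarrow> complex" and x :: 'v
  assumes "2 \<le> Q"
    and "homogeneous_tree adj Q"
    and "1 \<le> p" and "p \<le> 2"
    and "0 < Re z"
    and "in_Lp p f"
  shows "((\<lambda>R. riesz_mean adj Q R z f x) \<longlongrightarrow> f x) at_top"
proof -
  interpret homogeneous_tree adj Q by fact
  obtain M where M: "\<And>y. norm (f y) \<le> M"
    using in_Lp_bounded assms by (metis less_le_trans zero_less_one)
  \<comment> \<open>\<open>A / R\<close> is the ratio in the kernel estimate. In \<open>K\<close>,
    the 8 is the constant of that estimate and the 4 comes from the convolution.\<close>
  define A where "A = 3 * (norm z + 1)"
  define K where "K = 4 * 8 * M * (real Q + 1)"
  have A: "0 < A" by (simp add: A_def add_nonneg_pos)
  \<comment> \<open>The threshold on \<open>R\<close> gives A/R (Q + 1) \<le> 1/2 for the sum over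
    spheres, and hence A/R \<le> 1/2 for the kernel estimate.\<close>
  have "norm (riesz_mean adj Q R z f x - f x) \<le> K * (A / R)"
    if "2 * A * (real Q + 1) \<le> R" for R
  proof -
    have "0 < 2 * A * (real Q + 1)" using A by (intro mult_pos_pos) auto
    then have R: "0 < R" using that by linarith
    have q: "A / R * (real Q + 1) \<le> 1/2" using that R by (simp add: field_simps)
    have "A / R * 1 \<le> A / R * (real Q + 1)" using A R by (intro mult_left_mono) auto
    then have r: "A / R \<le> 1/2" using q by linarith
    show ?thesis
      unfolding riesz_mean_def K_def
      by (rule radial_convolution_approx_identity[OF M _ _ _ q])
        (use A R riesz_kernel_approx_delta[OF assms(1) R r[unfolded A_def]] in \<open>auto simp: A_def\<close>)
  qed
  then have "\<forall>\<^sub>F R in at_top. norm (riesz_mean adj Q R z f x - f x) \<le> K * (A / R)"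
    using eventually_ge_at_top by (rule eventually_mono[rotated])
  moreover have "((\<lambda>R. K * (A / R)) \<longlongrightarrow> 0) at_top"
    by (intro tendsto_mult_right_zero tendsto_divide_0[OF tendsto_const] filterlim_at_top_imp_at_infinity filterlim_ident)
  ultimately have "((\<lambda>R. riesz_mean adj Q R z f x - f x) \<longlongrightarrow> 0) at_top"
    by (rule Lim_null_comparison)
  then show ?thesis by (rule LIM_zero_cancel)
qed

end
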